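(* Let the vertices of $C_5$ be $v_0,\dots,v_4$ (with $v_i$ adjacent to $v_{i\pm1\bmod 5}$), and let $B$ be the distribution on $C_5\Box C_5$ with one pebble on each vertex $(v_i,v_{2i\bmod 5})$, $0\le i\le 4$, and none elsewhere. Let $G$ be any graph, $t$ a positive integer, and $D$ a $t$-solvable distribution on $G$ in which the number of pebbles on every vertex is a multiple of four. Then $B\cdot D$ is a $t$-solvable distribution on $(C_5\Box C_5)\Box G$ in which the number of pebbles on every vertex is a multiple of four, and $|B\cdot D|=5|D|$. In particular, for every integer $m\ge 0$, $\pi_t^*(C_5^{2m}\Box G)\le 5^m|D|$.
   Context: Graphs are finite simple graphs. A distribution on a graph $G=(V,E)$ is a function $D:V\to\mathbb{N}$, with size $|D|=\sum_v D(v)$. A pebbling move removes two pebbles from a vertex having at least two pebbles and places one pebble on a neighbor. A distribution $D$ is $t$-solvable if for every vertex $v$, some sequence of pebbling moves starting from $D$ results in a distribution with at least $t$ pebbles on $v$. The optimal $t$-pebbling number $\pi_t^*(G)$ is the minimum size of a $t$-solvable distribution on $G$. $\Box$ denotes the Cartesian product of graphs and $H^k$ the $k$-fold Cartesian product of $H$ with itself. For distributions $D$ on $G$ and $D'$ on $G'$, $D\cdot D'$ is the distribution on $G\Box G'$ with $(D\cdot D')((x,x'))=D(x)D'(x')$. *)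

theory Defs
  imports "Graph_Theory.Pair_Digraph"
begin

text \<open>
  A finite simple graph is a digraph given by a vertex set and a set of ordered pairs that satisfies
  the locale predicate \<^const>\<open>pair_graph\<close>: finite, symmetric, loop-free, with all arcs between vertices.
  An edge is thus represented by its two orientations.
\<close>

text \<open>The vertex \<open>v\<^sub>i\<close> is the number \<open>i\<close>.  The graph is simple only for \<open>n \<ge> 3\<close>; it is used with \<open>n = 5\<close>.\<close>

definition cycle_graph :: "nat \<Rightarrow> nat pair_pre_digraph" where
  "cycle_graph n = \<lparr> pverts = {..<n},
     parcs = {(i, j). i < n \<and> j < n \<and> (j = (i + 1) mod n \<or> i = (j + 1) mod n)} \<rparr>"

definition cart_prod ::
    "'a pair_pre_digraph \<Rightarrow> 'b pair_pre_digraph \<Rightarrow> ('a \<times> 'b) pair_pre_digraph" (infixr "\<box>" 70) where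
  "G \<box> H = \<lparr> pverts = pverts G \<times> pverts H,
     parcs = {((x, y), (x', y')).
        (x = x' \<and> x \<in> pverts G \<and> (y, y') \<in> parcs H) \<or>
        (y = y' \<and> y \<in> pverts H \<and> (x, x') \<in> parcs G)} \<rparr>"

text \<open>
  The vertices of the \<open>k\<close>-fold product of \<open>H\<close> are the lists of length \<open>k\<close> over the vertices of \<open>H\<close>,
  so that all powers of \<open>H\<close> live on one type.  The \<open>0\<close>-fold product is the one-vertex graph.
\<close>

primrec cart_power :: "'a pair_pre_digraph \<Rightarrow> nat \<Rightarrow> 'a list pair_pre_digraph" where
  "cart_power H 0 = \<lparr> pverts = {[]}, parcs = {} \<rparr>"
| "cart_power H (Suc k) =
     (let P = H \<box> cart_power H k; f = (\<lambda>(x, xs). x # xs)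
      in \<lparr> pverts = f ` pverts P, parcs = map_prod f f ` parcs P \<rparr>)"

text \<open>
  A distribution is a function on the vertex set; it is extended by \<open>0\<close> outside the vertex set.
\<close>

definition distribution :: "'a pair_pre_digraph \<Rightarrow> ('a \<Rightarrow> nat) \<Rightarrow> bool" where
  "distribution G D \<longleftrightarrow> (\<forall>v. v \<notin> pverts G \<longrightarrow> D v = 0)"

definition dist_size :: "'a pair_pre_digraph \<Rightarrow> ('a \<Rightarrow> nat) \<Rightarrow> nat" where
  "dist_size G D = (\<Sum>v\<in>pverts G. D v)"

definition pebbling_move :: "'a pair_pre_digraph \<Rightarrow> ('a \<Rightarrow> nat) \<Rightarrow> ('a \<Rightarrow> nat) \<Rightarrow> bool" where
  "pebbling_move G D D' \<longleftrightarrow>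
     (\<exists>u v. (u, v) \<in> parcs G \<and> 2 \<le> D u \<and> D' = D(u := D u - 2, v := D v + 1))"

definition t_solvable :: "'a pair_pre_digraph \<Rightarrow> nat \<Rightarrow> ('a \<Rightarrow> nat) \<Rightarrow> bool" where
  "t_solvable G t D \<longleftrightarrow> (\<forall>v\<in>pverts G. \<exists>D'. (pebbling_move G)\<^sup>*\<^sup>* D D' \<and> t \<le> D' v)"

definition opt_pebbling :: "nat \<Rightarrow> 'a pair_pre_digraph \<Rightarrow> nat" where
  "opt_pebbling t G = (LEAST n. \<exists>D. distribution G D \<and> t_solvable G t D \<and> dist_size G D = n)"

definition dist_prod :: "('a \<Rightarrow> nat) \<Rightarrow> ('b \<Rightarrow> nat) \<Rightarrow> 'a \<times> 'b \<Rightarrow> nat" (infixr "\<odot>" 70) where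
  "D \<odot> D' = (\<lambda>(x, x'). D x * D' x')"

definition B :: "nat \<times> nat \<Rightarrow> nat" where
  "B = (\<lambda>(i, j). if i < 5 \<and> j = (2 * i) mod 5 then 1 else 0)"

lemma pair_graph_cycle_graph:
  assumes "3 \<le> n"
  shows "pair_graph (cycle_graph n)"
proof unfold_locales
  show "finite (parcs (cycle_graph n))"
    by (rule finite_subset[of _ "{..<n} \<times> {..<n}"]) (auto simp: cycle_graph_def)
  show "fst e \<noteq> snd e" if "e \<in> parcs (cycle_graph n)" for e
    using that assms by (auto simp: cycle_graph_def mod_Suc split: if_splits)
qed (auto simp: cycle_graph_def symmetric_def sym_def)

lemma pair_graph_cart_prod:
  assumes "pair_graph G" "pair_graph H"
  shows "pair_graph (G \<box> H)"
proof -
  interpret G: pair_graph G by fact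
  interpret H: pair_graph H by fact
  have sub: "parcs (G \<box> H) \<subseteq> (pverts G \<times> pverts H) \<times> (pverts G \<times> pverts H)"
    by (auto simp: cart_prod_def dest: G.in_arcsD1 G.in_arcsD2 H.in_arcsD1 H.in_arcsD2)
  show ?thesis
  proof unfold_locales
    show "finite (parcs (G \<box> H))"
      by (rule finite_subset[OF sub]) (simp add: G.pair_finite_verts H.pair_finite_verts)
    show "fst e \<noteq> snd e" if "e \<in> parcs (G \<box> H)" for e
      using that by (auto simp: cart_prod_def dest: G.pair_no_loops H.pair_no_loops)
    show "symmetric (G \<box> H)"
      using G.pair_sym_arcs H.pair_sym_arcs
      by (auto simp: cart_prod_def symmetric_def sym_def)
    show "fst e \<in> pverts (G \<box> H)" "snd e \<in> pverts (G \<box> H)" if "e \<in> parcs (G \<box> H)" for e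
      using that
      by (auto simp: cart_prod_def dest: G.in_arcsD1 G.in_arcsD2 H.in_arcsD1 H.in_arcsD2)
  qed (simp add: cart_prod_def G.pair_finite_verts H.pair_finite_verts)
qed

lemma pair_graph_relabel:
  assumes "pair_graph G" "inj f"
  shows "pair_graph \<lparr> pverts = f ` pverts G, parcs = map_prod f f ` parcs G \<rparr>"
proof -
  interpret G: pair_graph G by fact
  show ?thesis
  proof unfold_locales
    show "symmetric (with_proj \<lparr> pverts = f ` pverts G, parcs = map_prod f f ` parcs G \<rparr>)"
      using G.pair_sym_arcs by (force simp: symmetric_def sym_def)
  qed (use assms(2) G.pair_no_loops in
        \<open>auto simp: G.pair_finite_verts G.pair_finite_arcs inj_eq dest: G.in_arcsD1 G.in_arcsD2\<close>)
qed

lemma pair_graph_cart_power: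
  assumes "pair_graph H"
  shows "pair_graph (cart_power H k)"
proof (induction k)
  case 0
  show ?case by unfold_locales (auto simp: symmetric_def sym_def)
next
  case (Suc k)
  have "inj (\<lambda>(x :: 'a, xs). x # xs)" by (auto simp: inj_def)
  from pair_graph_relabel[OF pair_graph_cart_prod[OF assms Suc] this]
  show ?case by (simp add: Let_def)
qed

lemma pverts_cart_power:
  "pverts (cart_power H k) = {xs. length xs = k \<and> set xs \<subseteq> pverts H}"
proof (induction k)
  case (Suc k)
  then show ?case
    by (auto simp: Let_def cart_prod_def length_Suc_conv image_iff)
qed auto

lemma distribution_B: "distribution (cycle_graph 5 \<box> cycle_graph 5) B"
  by (auto simp: distribution_def B_def cart_prod_def cycle_graph_def)

text \<open>The minimum in the definition of the optimal pebbling number is attained.\<close>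

lemma opt_pebbling_attained:
  "\<exists>D. distribution G D \<and> t_solvable G t D \<and> dist_size G D = opt_pebbling t G"
proof -
  let ?D = "\<lambda>v. if v \<in> pverts G then t else 0"
  have "distribution G ?D \<and> t_solvable G t ?D \<and> dist_size G ?D = dist_size G ?D"
    by (auto simp: distribution_def t_solvable_def intro!: exI[of _ ?D])
  then have "\<exists>n D. distribution G D \<and> t_solvable G t D \<and> dist_size G D = n"
    by blast
  then show ?thesis
    unfolding opt_pebbling_def by (rule LeastI_ex)
qed

end

theory Submission
  imports Defs
begin

text \<open>
  The support of \<open>B\<close> is a perfect code in \<open>C\<^sub>5 \<box> C\<^sub>5\<close>: a vertex \<open>w\<close> off the code has exactly one code
  vertex at distance 1 and two at distance 2, so four pebbles on each code vertex yield
  \<open>2 + 1 + 1 = 4\<close> pebbles on \<open>w\<close>.  As four divides every \<open>D g\<close>, these moves can be carried out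
  \<open>D g div 4\<close> times in each fibre over \<open>g \<in> G\<close>, which collects a full copy of \<open>D\<close> on \<open>{w} \<times> G\<close>.
\<close>

section \<open>Idle pebbles, multiples and embeddings of pebbling sequences\<close>

lemma pebbling_move_add:
  assumes "pebbling_move G D D'"
  shows "pebbling_move G (\<lambda>v. D v + C v) (\<lambda>v. D' v + C v)"
proof -
  obtain u v where "(u, v) \<in> parcs G" "2 \<le> D u" "D' = D(u := D u - 2, v := D v + 1)"
    using assms unfolding pebbling_move_def by blast
  then show ?thesis
    unfolding pebbling_move_def by (intro exI[of _ u] exI[of _ v]) auto
qed

lemma pebbling_moves_add:
  assumes "(pebbling_move G)\<^sup>*\<^sup>* D D'"
  shows "(pebbling_move G)\<^sup>*\<^sup>* (\<lambda>v. D v + C v) (\<lambda>v. D' v + C v)"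
  using assms
proof (induction rule: rtranclp_induct)
  case (step D' D'')
  then show ?case
    using pebbling_move_add rtranclp.rtrancl_into_rtrancl by metis
qed simp

text \<open>The copies are moved one after another: first one copy of \<open>D\<close> while the
  other \<open>n\<close> lie idle, then the remaining \<open>n\<close> while the finished
  \<open>D'\<close> lies idle.\<close>

lemma pebbling_moves_mult:
  assumes "(pebbling_move G)\<^sup>*\<^sup>* D D'"
  shows "(pebbling_move G)\<^sup>*\<^sup>* (\<lambda>v. n * D v) (\<lambda>v. n * D' v)"
proof (induction n)
  case (Suc n)
  have "(pebbling_move G)\<^sup>*\<^sup>* (\<lambda>v. D v + n * D v) (\<lambda>v. D' v + n * D v)"
    using assms by (rule pebbling_moves_add)
  moreover have "(pebbling_move G)\<^sup>*\<^sup>* (\<lambda>v. n * D v + D' v) (\<lambda>v. n * D' v + D' v)"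
    using Suc by (rule pebbling_moves_add)
  ultimately show ?case
    by (simp add: add.commute)
qed simp

text \<open>Each move along \<open>(u, v)\<close> is imitated along \<open>(f u, f v)\<close>;
  surplus pebbles of \<open>E\<close> on the image do no harm. The last conjunct confines all
  changes to the image, so that a single fibre of a product can be treated without disturbing the
  others.\<close>

lemma pebbling_moves_embed:
  assumes moves: "(pebbling_move G)\<^sup>*\<^sup>* D D'"
    and inj: "inj f"
    and arcs: "\<And>u v. (u, v) \<in> parcs G \<Longrightarrow> (f u, f v) \<in> parcs H"
    and le: "\<And>x. D x \<le> E (f x)"
  shows "\<exists>E'. (pebbling_move H)\<^sup>*\<^sup>* E E' \<and> (\<forall>x. D' x \<le> E' (f x)) \<and> (\<forall>y. y \<notin> range f \<longrightarrow> E' y = E y)"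
  using moves
proof (induction rule: rtranclp_induct)
  case base
  then show ?case using le by blast
next
  case (step D' D'')
  obtain E' where E': "(pebbling_move H)\<^sup>*\<^sup>* E E'" "\<And>x. D' x \<le> E' (f x)"
    "\<And>y. y \<notin> range f \<Longrightarrow> E' y = E y"
    using step.IH by blast
  obtain u v where uv: "(u, v) \<in> parcs G" "2 \<le> D' u" "D'' = D'(u := D' u - 2, v := D' v + 1)"
    using step.hyps(2) unfolding pebbling_move_def by blast
  define E'' where "E'' = E'(f u := E' (f u) - 2, f v := E' (f v) + 1)"
  have "pebbling_move H E' E''"
    unfolding pebbling_move_def E''_def
    using arcs[OF uv(1)] uv(2) E'(2)[of u] by (intro exI[of _ "f u"] exI[of _ "f v"]) auto
  with E'(1) have "(pebbling_move H)\<^sup>*\<^sup>* E E''" by simp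
  moreover have "D'' x \<le> E'' (f x)" for x
    using E'(2)[of u] E'(2)[of v] E'(2)[of x] by (auto simp: E''_def uv(3) inj_eq[OF inj])
  moreover have "E'' y = E y" if "y \<notin> range f" for y
    using E'(3)[OF that] that by (auto simp: E''_def)
  ultimately show ?case by blast
qed

section \<open>Products of distributions and relabelling of vertices\<close>

text \<open>The general principle behind the construction, later applied with \<open>p = 4\<close>
  and \<open>E = B\<close>: if \<open>D h = p * n\<close>, the fibre over \<open>h\<close> holds
  \<open>n\<close> copies of \<open>p * E\<close> and can deliver \<open>n * p = D h\<close> pebbles
  to \<open>(w, h)\<close>.\<close>

lemma t_solvable_dist_prod:
  assumes fin: "finite (pverts G)"
    and E: "t_solvable H p (\<lambda>x. p * E x)"
    and dist: "distribution G D"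
    and D: "t_solvable G t D"
    and dvd: "\<And>g. g \<in> pverts G \<Longrightarrow> p dvd D g"
  shows "t_solvable (H \<box> G) t (E \<odot> D)"
  unfolding t_solvable_def
proof
  fix z assume "z \<in> pverts (H \<box> G)"
  then obtain w g where z: "z = (w, g)" and w: "w \<in> pverts H" and g: "g \<in> pverts G"
    by (auto simp: cart_prod_def)
  obtain A where A: "(pebbling_move H)\<^sup>*\<^sup>* (\<lambda>x. p * E x) A" "p \<le> A w"
    using E w unfolding t_solvable_def by blast
  \<comment> \<open>The fibres are emptied towards \<open>w\<close> one at a time. The last conjunct
    records that fibres outside \<open>S\<close> still carry \<open>E \<odot> D\<close>, which is
    the starting position for the next one.\<close>
  have collect: "\<exists>F. (pebbling_move (H \<box> G))\<^sup>*\<^sup>* (E \<odot> D) F \<and> (\<forall>h\<in>S. D h \<le> F (w, h)) \<and>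
      (\<forall>h x. h \<notin> S \<longrightarrow> F (x, h) = E x * D h)" if "finite S" "S \<subseteq> pverts G" for S
    using that
  proof (induction S rule: finite_induct)
    case empty
    then show ?case by (auto simp: dist_prod_def intro!: exI[of _ "E \<odot> D"])
  next
    case (insert h S)
    obtain F where F: "(pebbling_move (H \<box> G))\<^sup>*\<^sup>* (E \<odot> D) F" "\<And>h'. h' \<in> S \<Longrightarrow> D h' \<le> F (w, h')"
      "\<And>h' x. h' \<notin> S \<Longrightarrow> F (x, h') = E x * D h'"
      using insert by auto
    obtain n where n: "D h = p * n" using dvd[of h] insert.prems by auto
    have "\<exists>F'. (pebbling_move (H \<box> G))\<^sup>*\<^sup>* F F' \<and> (\<forall>x. n * A x \<le> F' (x, h)) \<and>
        (\<forall>y. y \<notin> range (\<lambda>x. (x, h)) \<longrightarrow> F' y = F y)"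
    proof (rule pebbling_moves_embed)
      show "(pebbling_move H)\<^sup>*\<^sup>* (\<lambda>x. n * (p * E x)) (\<lambda>x. n * A x)"
        using A(1) by (rule pebbling_moves_mult)
      show "n * (p * E x) \<le> F (x, h)" for x
        using F(3)[OF insert.hyps(2)] n by (simp add: ac_simps)
    qed (use insert.prems in \<open>auto simp: inj_def cart_prod_def\<close>)
    then obtain F' where F': "(pebbling_move (H \<box> G))\<^sup>*\<^sup>* F F'" "\<And>x. n * A x \<le> F' (x, h)"
        "\<And>y. y \<notin> range (\<lambda>x. (x, h)) \<Longrightarrow> F' y = F y"
      by blast
    have "D h \<le> F' (w, h)"
      using n A(2) F'(2)[of w] by (metis le_trans mult.commute mult_le_mono2)
    moreover have "F' (x, h') = F (x, h')" if "h' \<noteq> h" for x h'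
      using F'(3) that by auto
    ultimately have "\<forall>h'\<in>insert h S. D h' \<le> F' (w, h')"
        "\<forall>h' x. h' \<notin> insert h S \<longrightarrow> F' (x, h') = E x * D h'"
      using F(2,3) insert.hyps(2) by (metis insertE, metis insertCI)
    with F(1) F'(1) show ?case by (meson rtranclp_trans)
  qed
  obtain F where F: "(pebbling_move (H \<box> G))\<^sup>*\<^sup>* (E \<odot> D) F" "\<And>h. h \<in> pverts G \<Longrightarrow> D h \<le> F (w, h)"
    using collect[OF fin] by auto
  \<comment> \<open>The embedding lemma compares distributions on the whole type, so points outside
    \<open>G\<close> count too; there \<open>D\<close> is 0.\<close>
  have le: "D h \<le> F (w, h)" for h
    using F(2) dist unfolding distribution_def by (cases "h \<in> pverts G") auto
  obtain D' where D': "(pebbling_move G)\<^sup>*\<^sup>* D D'" "t \<le> D' g"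
    using D g unfolding t_solvable_def by blast
  \<comment> \<open>The copy of \<open>D\<close> collected on the fibre over \<open>w\<close> is now
    played as in \<open>G\<close>.\<close>
  have "\<exists>F'. (pebbling_move (H \<box> G))\<^sup>*\<^sup>* F F' \<and> (\<forall>x. D' x \<le> F' (w, x)) \<and>
      (\<forall>y. y \<notin> range (Pair w) \<longrightarrow> F' y = F y)"
    using D'(1) by (rule pebbling_moves_embed) (use w le in \<open>auto simp: inj_def cart_prod_def\<close>)
  then show "\<exists>F'. (pebbling_move (H \<box> G))\<^sup>*\<^sup>* (E \<odot> D) F' \<and> t \<le> F' z"
    using F(1) D'(2) z by (metis le_trans rtranclp_trans)
qed

lemma dist_size_dist_prod: "dist_size (H \<box> G) (E \<odot> D) = dist_size H E * dist_size G D"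
  by (simp add: dist_size_def cart_prod_def dist_prod_def sum_product sum.cartesian_product)

lemma distribution_dist_prod:
  "distribution H E \<Longrightarrow> distribution G D \<Longrightarrow> distribution (H \<box> G) (E \<odot> D)"
  by (auto simp: distribution_def cart_prod_def dist_prod_def)

text \<open>Used to pass between nested pairs and lists as vertex names. Arcs need only map forward,
  because moves of \<open>G\<close> are imitated in \<open>H\<close>. The values
  \<open>D' (f x)\<close> are exposed so that divisibility can be carried over as well.\<close>

lemma t_solvable_transfer:
  fixes f :: "'a \<Rightarrow> 'b"
  assumes inj: "inj f"
    and verts: "pverts H = f ` pverts G"
    and arcs: "\<And>u v. (u, v) \<in> parcs G \<Longrightarrow> (f u, f v) \<in> parcs H"
    and dist: "distribution G D"
    and solv: "t_solvable G t D"
  shows "\<exists>D'. (\<forall>x. D' (f x) = D x) \<and> distribution H D' \<and> t_solvable H t D' \<and>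
    dist_size H D' = dist_size G D"
proof -
  define D' where "D' y = (if y \<in> range f then D (inv f y) else 0)" for y
  have D'f: "D' (f x) = D x" for x
    by (simp add: D'_def inj)
  have "distribution H D'"
    unfolding distribution_def
  proof (intro allI impI)
    fix y assume "y \<notin> pverts H"
    then show "D' y = 0"
      using dist D'f by (cases "y \<in> range f") (auto simp: verts distribution_def D'_def inj)
  qed
  moreover have "t_solvable H t D'"
    unfolding t_solvable_def
  proof
    fix y assume "y \<in> pverts H"
    then obtain x where x: "x \<in> pverts G" "y = f x" using verts by auto
    obtain A where A: "(pebbling_move G)\<^sup>*\<^sup>* D A" "t \<le> A x"
      using solv x(1) unfolding t_solvable_def by blast
    have "\<exists>A'. (pebbling_move H)\<^sup>*\<^sup>* D' A' \<and> (\<forall>x. A x \<le> A' (f x)) \<and>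
        (\<forall>y. y \<notin> range f \<longrightarrow> A' y = D' y)"
      using A(1) inj arcs by (rule pebbling_moves_embed) (auto simp: D'f)
    with A(2) x(2) show "\<exists>A'. (pebbling_move H)\<^sup>*\<^sup>* D' A' \<and> t \<le> A' y"
      by (metis le_trans)
  qed
  moreover have "dist_size H D' = dist_size G D"
    unfolding dist_size_def verts using inj
    by (subst sum.reindex) (auto simp: D'f intro: inj_on_subset)
  ultimately show ?thesis using D'f by blast
qed

section \<open>The perfect code in the torus\<close>

lemma pebbling_moves_arc:
  assumes "(u, v) \<in> parcs G" "u \<noteq> v" "2 * k \<le> D u"
  shows "(pebbling_move G)\<^sup>*\<^sup>* D (D(u := D u - 2 * k, v := D v + k))"
  using assms(3)
proof (induction k)
  case (Suc k)
  let ?D = "D(u := D u - 2 * k, v := D v + k)"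
  have "D(u := D u - 2 * Suc k, v := D v + Suc k) = ?D(u := ?D u - 2, v := ?D v + 1)"
    using assms(2) by auto
  moreover have "2 \<le> ?D u" using Suc.prems assms(2) by simp
  ultimately have "pebbling_move G ?D (D(u := D u - 2 * Suc k, v := D v + Suc k))"
    unfolding pebbling_move_def using assms(1) by blast
  moreover have "(pebbling_move G)\<^sup>*\<^sup>* D ?D"
    by (rule Suc.IH) (use Suc.prems in simp)
  ultimately show ?case by (rule rtranclp.rtrancl_into_rtrancl[rotated])
qed simp

text \<open>Two moves from \<open>b\<close> put two pebbles on \<open>u\<close>, and one move passes
  them on to \<open>w\<close>; the middle vertex \<open>u\<close> ends with the count it had
  before.\<close>

lemma pebbling_moves_path2:
  assumes "(b, u) \<in> parcs G" "(u, w) \<in> parcs G" "distinct [b, u, w]" "4 \<le> D b"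
  shows "(pebbling_move G)\<^sup>*\<^sup>* D (D(b := D b - 4, w := D w + 1))"
proof -
  let ?D = "D(b := D b - 2 * 2, u := D u + 2)"
  have "(pebbling_move G)\<^sup>*\<^sup>* D ?D"
    using assms by (intro pebbling_moves_arc) auto
  moreover have "(pebbling_move G)\<^sup>*\<^sup>* ?D (?D(u := ?D u - 2 * 1, w := ?D w + 1))"
    using assms by (intro pebbling_moves_arc) auto
  moreover have "?D(u := ?D u - 2 * 1, w := ?D w + 1) = D(b := D b - 4, w := D w + 1)"
    using assms(3) by auto
  ultimately show ?thesis by simp
qed

text \<open>An executable adjacency test, to be evaluated by \<open>code_simp\<close>. The bounds on
  the coordinates are left to membership in \<open>torus_verts\<close>.\<close>

definition torus_adj :: "nat \<times> nat \<Rightarrow> nat \<times> nat \<Rightarrow> bool" where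
  "torus_adj = (\<lambda>(i, j) (i', j').
     i = i' \<and> (j' = (j + 1) mod 5 \<or> j = (j' + 1) mod 5) \<or>
     j = j' \<and> (i' = (i + 1) mod 5 \<or> i = (i' + 1) mod 5))"

definition torus_verts :: "(nat \<times> nat) list" where
  "torus_verts = List.product [0..<5] [0..<5]"

lemma set_torus_verts: "set torus_verts = pverts (cycle_graph 5 \<box> cycle_graph 5)"
  by (auto simp: torus_verts_def cart_prod_def cycle_graph_def)

lemma torus_adj_arc:
  assumes "torus_adj u v" "u \<in> set torus_verts" "v \<in> set torus_verts"
  shows "(u, v) \<in> parcs (cycle_graph 5 \<box> cycle_graph 5)"
  using assms by (auto simp: torus_verts_def torus_adj_def cart_prod_def cycle_graph_def)

text \<open>A finite check over 25 vertices. The neighbour of \<open>w\<close> is \<open>b\<close>,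
  and \<open>c\<close>, \<open>d\<close> lie two steps away. The middle vertices are taken off the
  code, which separates them from \<open>c\<close> and \<open>d\<close>.\<close>

lemma code_distances:
  "\<forall>w\<in>set torus_verts. B w = 1 \<or>
     (\<exists>b\<in>set torus_verts. B b = 1 \<and> torus_adj b w \<and>
     (\<exists>c\<in>set torus_verts. B c = 1 \<and> c \<noteq> b \<and>
       (\<exists>u\<in>set torus_verts. B u = 0 \<and> torus_adj c u \<and> torus_adj u w \<and> u \<noteq> w) \<and>
     (\<exists>d\<in>set torus_verts. B d = 1 \<and> d \<noteq> b \<and> d \<noteq> c \<and>
       (\<exists>u\<in>set torus_verts. B u = 0 \<and> torus_adj d u \<and> torus_adj u w \<and> u \<noteq> w))))"
  by code_simp

lemma t_solvable_B: "t_solvable (cycle_graph 5 \<box> cycle_graph 5) 4 (\<lambda>x. 4 * B x)"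
  unfolding t_solvable_def
proof
  let ?T = "cycle_graph 5 \<box> cycle_graph 5"
  fix w assume "w \<in> pverts ?T"
  then have w: "w \<in> set torus_verts" by (simp add: set_torus_verts)
  show "\<exists>D'. (pebbling_move ?T)\<^sup>*\<^sup>* (\<lambda>x. 4 * B x) D' \<and> 4 \<le> D' w"
  proof (cases "B w = 1")
    case True
    then show ?thesis by (intro exI[of _ "\<lambda>x. 4 * B x"]) simp
  next
    case False
    then have Bw: "B w = 0" by (auto simp: B_def split: prod.splits if_splits)
    from code_distances[rule_format, OF w] False obtain b c d u v where
      verts: "b \<in> set torus_verts" "c \<in> set torus_verts" "d \<in> set torus_verts"
        "u \<in> set torus_verts" "v \<in> set torus_verts"
      and code: "B b = 1" "B c = 1" "B d = 1" "B u = 0" "B v = 0"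
      and adj: "torus_adj b w" "torus_adj c u" "torus_adj u w" "torus_adj d v" "torus_adj v w"
      and neq: "c \<noteq> b" "d \<noteq> b" "d \<noteq> c" "u \<noteq> w" "v \<noteq> w"
      by blast
    \<comment> \<open>Code vertices have \<open>B\<close>-value 1, whereas \<open>w\<close>,
      \<open>u\<close> and \<open>v\<close> have value 0.\<close>
    have off: "b \<noteq> w" "c \<noteq> w" "d \<noteq> w" "c \<noteq> u" "d \<noteq> v"
      using code Bw by auto
    define D0 :: "nat \<times> nat \<Rightarrow> nat" where "D0 = (\<lambda>x. 4 * B x)"
    \<comment> \<open>The contributions to \<open>w\<close> are two pebbles from \<open>b\<close>,
      one from \<open>c\<close> through \<open>u\<close>, and one from \<open>d\<close> through
      \<open>v\<close>.\<close>
    define D1 where "D1 = D0(b := D0 b - 2 * 2, w := D0 w + 2)"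
    define D2 where "D2 = D1(c := D1 c - 4, w := D1 w + 1)"
    define D3 where "D3 = D2(d := D2 d - 4, w := D2 w + 1)"
    have "(pebbling_move ?T)\<^sup>*\<^sup>* D0 D1"
      unfolding D1_def using torus_adj_arc adj(1) verts w off code
      by (intro pebbling_moves_arc) (auto simp: D0_def)
    also have "(pebbling_move ?T)\<^sup>*\<^sup>* D1 D2"
      unfolding D2_def using verts w off code neq adj
      by (intro pebbling_moves_path2[where u = u] torus_adj_arc) (auto simp: D0_def D1_def)
    also have "(pebbling_move ?T)\<^sup>*\<^sup>* D2 D3"
      unfolding D3_def using verts w off code neq adj
      by (intro pebbling_moves_path2[where u = v] torus_adj_arc) (auto simp: D0_def D1_def D2_def)
    finally show ?thesis
      using off by (auto simp: D0_def D1_def D2_def D3_def intro!: exI[of _ D3])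
  qed
qed

lemma dist_size_B: "dist_size (cycle_graph 5 \<box> cycle_graph 5) B = 5"
proof -
  have "sum B (set torus_verts) = 5" by code_simp
  then show ?thesis by (simp add: dist_size_def set_torus_verts)
qed

lemma dvd_dist_prod:
  assumes "\<forall>v\<in>pverts G. n dvd D v"
  shows "\<forall>w\<in>pverts (H \<box> G). n dvd (E \<odot> D) w"
  using assms by (auto simp: cart_prod_def dist_prod_def)

section \<open>Even powers of the 5-cycle\<close>

lemma pverts_cart_prod: "pverts (G \<box> H) = pverts G \<times> pverts H"
  by (simp add: cart_prod_def)

lemma arc_cart_prod_iff:
  "((x, y), (x', y')) \<in> parcs (G \<box> H) \<longleftrightarrow>
     x = x' \<and> x \<in> pverts G \<and> (y, y') \<in> parcs H \<or> y = y' \<and> y \<in> pverts H \<and> (x, x') \<in> parcs G"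
  by (simp add: cart_prod_def)

lemma Cons_in_pverts_cart_power_iff:
  "x # xs \<in> pverts (cart_power H (Suc k)) \<longleftrightarrow> x \<in> pverts H \<and> xs \<in> pverts (cart_power H k)"
  unfolding pverts_cart_power by auto

text \<open>The arcs of a power are the image of product arcs under consing; injectivity of that map
  strips the image. This peels off coordinates without unfolding \<open>cart_power\<close>.\<close>

lemma arc_cart_power_Cons_iff:
  "(x # xs, y # ys) \<in> parcs (cart_power H (Suc k)) \<longleftrightarrow>
     ((x, xs), (y, ys)) \<in> parcs (H \<box> cart_power H k)"
proof -
  have "(x # xs, y # ys) = map_prod (\<lambda>(x, xs). x # xs) (\<lambda>(x, xs). x # xs) ((x, xs), (y, ys))"
    by simp
  moreover have "inj (map_prod (\<lambda>(x :: 'a, xs). x # xs) (\<lambda>(x :: 'a, xs). x # xs))"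
    by (auto simp: inj_def)
  ultimately show ?thesis
    by (simp only: cart_power.simps Let_def pair_pre_digraph.simps inj_image_mem_iff)
qed

text \<open>Divisibility by four is part of the claim because the product with \<open>B\<close> is
  applied again at each step, with the graph built so far in the role of \<open>G\<close>.\<close>

lemma exists_t_solvable_cycle_power:
  assumes G: "pair_graph G" and dist: "distribution G D" and solv: "t_solvable G t D"
    and dvd: "\<forall>v\<in>pverts G. 4 dvd D v"
  shows "\<exists>D'. distribution (cart_power (cycle_graph 5) (2 * m) \<box> G) D' \<and>
    t_solvable (cart_power (cycle_graph 5) (2 * m) \<box> G) t D' \<and>
    (\<forall>v\<in>pverts (cart_power (cycle_graph 5) (2 * m) \<box> G). 4 dvd D' v) \<and>
    dist_size (cart_power (cycle_graph 5) (2 * m) \<box> G) D' = 5 ^ m * dist_size G D"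
proof (induction m)
  case 0
  let ?H = "cart_power (cycle_graph 5) (2 * 0) \<box> G"
  \<comment> \<open>The zeroth power is the single vertex \<open>[]\<close>, so \<open>?H\<close> is
    a copy of \<open>G\<close>.\<close>
  have verts: "pverts ?H = Pair [] ` pverts G"
    by (auto simp: cart_prod_def)
  obtain D' where "\<forall>x. D' ([], x) = D x" "distribution ?H D'" "t_solvable ?H t D'"
      "dist_size ?H D' = dist_size G D"
    using t_solvable_transfer[OF _ verts _ dist solv] by (auto simp: inj_def cart_prod_def)
  moreover from this(1) dvd have "\<forall>v\<in>pverts ?H. 4 dvd D' v"
    unfolding verts by simp
  ultimately show ?case by auto
next
  case (Suc m)
  let ?P = "cart_power (cycle_graph 5) (2 * m)"
  let ?T = "cycle_graph 5 \<box> cycle_graph 5"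
  let ?H = "cart_power (cycle_graph 5) (2 * Suc m) \<box> G"
  \<comment> \<open>One factor \<open>?T\<close> accounts for the two leading list entries, as
    \<open>2 * Suc m\<close> exceeds \<open>2 * m\<close> by two.\<close>
  let ?f = "\<lambda>((a, b), (xs, g)). (a # b # xs, g)"
  obtain D1 where D1: "distribution (?P \<box> G) D1" "t_solvable (?P \<box> G) t D1"
    "\<forall>v\<in>pverts (?P \<box> G). 4 dvd D1 v" "dist_size (?P \<box> G) D1 = 5 ^ m * dist_size G D"
    using Suc.IH by blast
  \<comment> \<open>Supplies the finite vertex set over which fibres are collected.\<close>
  interpret P: pair_graph "?P \<box> G"
    by (intro pair_graph_cart_prod pair_graph_cart_power pair_graph_cycle_graph G) simp
  have solv1: "t_solvable (?T \<box> (?P \<box> G)) t (B \<odot> D1)"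
    using t_solvable_dist_prod[OF P.pair_finite_verts t_solvable_B D1(1,2)] D1(3) by blast
  have dist1: "distribution (?T \<box> (?P \<box> G)) (B \<odot> D1)"
    by (rule distribution_dist_prod[OF distribution_B D1(1)])
  have inj: "inj ?f" by (auto simp: inj_def)
  have verts: "pverts ?H = ?f ` pverts (?T \<box> (?P \<box> G))"
  proof (intro equalityI subsetI)
    fix y assume "y \<in> pverts ?H"
    then obtain l g where y: "y = (l, g)" "l \<in> pverts (cart_power (cycle_graph 5) (Suc (Suc (2 * m))))"
        "g \<in> pverts G"
      by (auto simp: pverts_cart_prod simp del: cart_power.simps)
    then obtain a b xs where "l = a # b # xs"
      unfolding pverts_cart_power by (auto simp: length_Suc_conv)
    with y have "y = ?f ((a, b), (xs, g))" "((a, b), (xs, g)) \<in> pverts (?T \<box> (?P \<box> G))"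
      by (simp_all add: pverts_cart_prod Cons_in_pverts_cart_power_iff del: cart_power.simps)
    then show "y \<in> ?f ` pverts (?T \<box> (?P \<box> G))" by (rule image_eqI)
  next
    fix y assume "y \<in> ?f ` pverts (?T \<box> (?P \<box> G))"
    then show "y \<in> pverts ?H"
      by (auto simp: pverts_cart_prod Cons_in_pverts_cart_power_iff simp del: cart_power.simps)
  qed
  have arcs: "(?f u, ?f v) \<in> parcs ?H" if "(u, v) \<in> parcs (?T \<box> (?P \<box> G))" for u v
  proof -
    obtain a b xs g where u: "u = ((a, b), (xs, g))" by (metis surj_pair)
    obtain a' b' xs' g' where v: "v = ((a', b'), (xs', g'))" by (metis surj_pair)
    show ?thesis
      using that unfolding u v
      by (auto simp: arc_cart_prod_iff arc_cart_power_Cons_iff pverts_cart_prod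
          Cons_in_pverts_cart_power_iff simp del: cart_power.simps)
  qed
  obtain D2 where D2: "\<forall>x. D2 (?f x) = (B \<odot> D1) x" "distribution ?H D2" "t_solvable ?H t D2"
      "dist_size ?H D2 = dist_size (?T \<box> (?P \<box> G)) (B \<odot> D1)"
    using t_solvable_transfer[OF inj verts arcs dist1 solv1] by blast
  have "\<forall>v\<in>pverts ?H. 4 dvd D2 v"
    unfolding verts ball_simps D2(1)[rule_format] using D1(3) by (rule dvd_dist_prod)
  moreover have "dist_size ?H D2 = 5 ^ Suc m * dist_size G D"
    using D2(4) D1(4) by (simp add: dist_size_dist_prod dist_size_B)
  ultimately show ?case using D2(2,3) by blast
qed

theorem theorem5p2:
  fixes G :: "'a pair_pre_digraph" and t :: nat and D :: "'a \<Rightarrow> nat"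
  assumes "pair_graph G"
    and "t > 0"
    and "distribution G D"
    and "t_solvable G t D"
    and "\<forall>v\<in>pverts G. 4 dvd D v"
  shows "distribution ((cycle_graph 5 \<box> cycle_graph 5) \<box> G) (B \<odot> D) \<and>
    t_solvable ((cycle_graph 5 \<box> cycle_graph 5) \<box> G) t (B \<odot> D) \<and>
    (\<forall>w\<in>pverts ((cycle_graph 5 \<box> cycle_graph 5) \<box> G). 4 dvd (B \<odot> D) w) \<and>
    dist_size ((cycle_graph 5 \<box> cycle_graph 5) \<box> G) (B \<odot> D) = 5 * dist_size G D \<and>
    (\<forall>m :: nat. opt_pebbling t (cart_power (cycle_graph 5) (2 * m) \<box> G) \<le> 5 ^ m * dist_size G D)"
proof (intro conjI allI)
  interpret pair_graph G by fact
  show "distribution ((cycle_graph 5 \<box> cycle_graph 5) \<box> G) (B \<odot> D)"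
    using distribution_B assms(3) by (rule distribution_dist_prod)
  show "t_solvable ((cycle_graph 5 \<box> cycle_graph 5) \<box> G) t (B \<odot> D)"
    using t_solvable_dist_prod[OF pair_finite_verts t_solvable_B assms(3,4)] assms(5) by blast
  show "\<forall>w\<in>pverts ((cycle_graph 5 \<box> cycle_graph 5) \<box> G). 4 dvd (B \<odot> D) w"
    using assms(5) by (rule dvd_dist_prod)
  show "dist_size ((cycle_graph 5 \<box> cycle_graph 5) \<box> G) (B \<odot> D) = 5 * dist_size G D"
    by (simp add: dist_size_dist_prod dist_size_B)
  show "opt_pebbling t (cart_power (cycle_graph 5) (2 * m) \<box> G) \<le> 5 ^ m * dist_size G D" for m
    unfolding opt_pebbling_def
    using exists_t_solvable_cycle_power[OF assms(1,3-5), of m] by (intro Least_le) blast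
qed

end
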